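(* For complex parameters $\beta_1,\beta_2$ define the map $R(\beta_1,\beta_2):(x,y)\mapsto(p,q)$ by $$(p^1,p^2)=(y^1P^{-1},\;y^2P),\qquad (q^1,q^2)=(x^1P,\;x^2Q),$$ $$P=1+(\beta_2-\beta_1)\frac{1-x^1}{\beta_2x^1+y^2},\qquad Q=1+(\beta_1-\beta_2)\frac{y^2/x^2-x^1}{\beta_1x^1+y^2}.$$ Then: (a) whenever $u,v,u_{(1)},u_{(2)},v_{(2)},u_{(1,2)},v_{(1,2)}$ satisfy $$u_{(1,2)}=u+(\beta_2-\beta_1)\frac{u_{(1)}-u}{\beta_2+u_{(1)}v_{(2)}},\qquad v_{(1,2)}=v+(\beta_1-\beta_2)\frac{v_{(2)}-v}{\beta_1+u_{(1)}v_{(2)}},$$ the quantities $x=(u/u_{(1)},\,v\,u_{(1)})$, $y=(u_{(2)}/u,\,u\,v_{(2)})$, $p=(u_{(2)}/u_{(1,2)},\,v_{(2)}u_{(1,2)})$, $q=(u_{(1,2)}/u_{(1)},\,u_{(1)}v_{(1,2)})$ satisfy $(p,q)=R(\beta_1,\beta_2)(x,y)$; (b) $R$ satisfies the parameter-dependent Yang-Baxter relation $$R^{(2,3)}(\beta_2,\beta_3)\,R^{(1,3)}(\beta_1,\beta_3)\,R^{(1,2)}(\beta_1,\beta_2)=R^{(1,2)}(\beta_1,\beta_2)\,R^{(1,3)}(\beta_1,\beta_3)\,R^{(2,3)}(\beta_2,\beta_3).$$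
   Context: Here $x=(x^1,x^2)$, etc.; upper indices on $x,y,p,q$ denote components, not powers (except $P^{-1}=1/P$). All variables are complex scalars; identities are understood for generic values, where all expressions are defined (equalities of rational maps). $R^{(i,j)}$ acts on triples $(x,y,z)$ of elements of $\mathbb{C}^2$ as $R$ on the $i$-th and $j$-th entries (in this order) and as the identity on the remaining entry; products are compositions. Subscripts in parentheses are just names for the (shifted) field values on the vertices of an elementary square. *)

theory Defs
  imports "HOL-Analysis.Analysis"
begin

type_synonym C2 = "complex \<times> complex"

definition P_factor :: "complex \<Rightarrow> complex \<Rightarrow> C2 \<Rightarrow> C2 \<Rightarrow> complex" where
  "P_factor \<beta>1 \<beta>2 x y = 1 + (\<beta>2 - \<beta>1) * ((1 - fst x) / (\<beta>2 * fst x + snd y))"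

definition Q_factor :: "complex \<Rightarrow> complex \<Rightarrow> C2 \<Rightarrow> C2 \<Rightarrow> complex" where
  "Q_factor \<beta>1 \<beta>2 x y = 1 + (\<beta>1 - \<beta>2) * ((snd y / snd x - fst x) / (\<beta>1 * fst x + snd y))"

(* Rational maps are rendered as partial functions: the value is None exactly where some
   denominator occurring in the defining formulas vanishes, so the convention a / 0 = 0
   never enters a defined value. *)
definition R_map :: "complex \<Rightarrow> complex \<Rightarrow> C2 \<times> C2 \<rightharpoonup> C2 \<times> C2" where
  "R_map \<beta>1 \<beta>2 = (\<lambda>(x, y).
     if \<beta>2 * fst x + snd y \<noteq> 0 \<and> \<beta>1 * fst x + snd y \<noteq> 0 \<and> snd x \<noteq> 0
        \<and> P_factor \<beta>1 \<beta>2 x y \<noteq> 0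
     then Some ((fst y * inverse (P_factor \<beta>1 \<beta>2 x y), snd y * P_factor \<beta>1 \<beta>2 x y),
                (fst x * P_factor \<beta>1 \<beta>2 x y, snd x * Q_factor \<beta>1 \<beta>2 x y))
     else None)"

definition act12 :: "('a \<times> 'a \<rightharpoonup> 'a \<times> 'a) \<Rightarrow> 'a \<times> 'a \<times> 'a \<rightharpoonup> 'a \<times> 'a \<times> 'a" where
  "act12 F = (\<lambda>(x, y, z). map_option (\<lambda>(p, q). (p, q, z)) (F (x, y)))"

definition act13 :: "('a \<times> 'a \<rightharpoonup> 'a \<times> 'a) \<Rightarrow> 'a \<times> 'a \<times> 'a \<rightharpoonup> 'a \<times> 'a \<times> 'a" where
  "act13 F = (\<lambda>(x, y, z). map_option (\<lambda>(p, q). (p, y, q)) (F (x, z)))"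

definition act23 :: "('a \<times> 'a \<rightharpoonup> 'a \<times> 'a) \<Rightarrow> 'a \<times> 'a \<times> 'a \<rightharpoonup> 'a \<times> 'a \<times> 'a" where
  "act23 F = (\<lambda>(x, y, z). map_option (\<lambda>(p, q). (x, p, q)) (F (y, z)))"

(* Equality of rational maps: both sides are defined on a common dense open set and agree
   wherever both are defined. For the domains arising here, which are complements of zero sets
   of polynomials, density in the Euclidean topology is the same as Zariski density; it rules
   out vacuous equalities between compositions that are nowhere defined. *)
definition rational_map_eq ::
    "('a::topological_space \<rightharpoonup> 'b) \<Rightarrow> ('a \<rightharpoonup> 'b) \<Rightarrow> bool" where
  "rational_map_eq F G \<longleftrightarrow>
     open (dom F \<inter> dom G) \<and> closure (dom F \<inter> dom G) = UNIV \<and>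
     (\<forall>t \<in> dom F \<inter> dom G. F t = G t)"

end

theory Submission
  imports Defs
begin

text \<open>
  Part (a) is a substitution: along solutions of the lattice equations the factors of the map are
  ratios of field values, \<open>P = u12 / u\<close> and \<open>Q = v12 / v\<close>, and the remaining powers of
  \<open>u\<close> and \<open>u1\<close> cancel.

  Part (b) has an algebraic and a topological half. For the algebra, both triple compositions are
  computed in closed form. Each intermediate denominator factors over a short list of polynomials,
  because adjacent steps share factors that cancel
  (\<open>yb_factorisations\<close>); what is left on either side is the same triple \<open>yb_image\<close>
  (\<open>yb_left\<close>, \<open>yb_right\<close>), wherever that side is defined.

  For the topology, the compositions must be defined on a dense open set, for all parameters
  including degenerate ones. Density of the domain of each factor is not enough, since the image of
  one factor could lie outside the domain of the next. Two properties of partial maps that do pass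
  to compositions are used instead: preimages of open sets are open, and images of nonempty open
  sets contain nonempty open sets. The second holds for \<open>R\<close> because \<open>R\<close> is reversible: with
  the two arguments swapped on both sides, the map with interchanged parameters is its inverse
  (\<open>R_map_reversible\<close>), so images under \<open>R\<close> contain preimages under a continuous partial map.
\<close>

section \<open>Continuous and quasi-open partial maps\<close>

definition partial_continuous :: "('a::topological_space \<rightharpoonup> 'b::topological_space) \<Rightarrow> bool" where
  "partial_continuous F \<longleftrightarrow> (\<forall>V. open V \<longrightarrow> open {t. \<exists>w\<in>V. F t = Some w})"

text \<open>
  Applied to every nonempty open set, this contains density of the domain, and it is the form of
  dominance that survives composition and products with an identity.
\<close>

definition quasi_open :: "('a::topological_space \<rightharpoonup> 'b::topological_space) \<Rightarrow> bool" where
  "quasi_open F \<longleftrightarrow>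
     (\<forall>W. open W \<longrightarrow> W \<noteq> {} \<longrightarrow> (\<exists>V. open V \<and> V \<noteq> {} \<and> (\<forall>w\<in>V. \<exists>t\<in>W. F t = Some w)))"

lemma partial_continuousD: "partial_continuous F \<Longrightarrow> open V \<Longrightarrow> open {t. \<exists>w\<in>V. F t = Some w}"
  by (simp add: partial_continuous_def)

lemma quasi_openD:
  "quasi_open F \<Longrightarrow> open W \<Longrightarrow> W \<noteq> {} \<Longrightarrow> \<exists>V. open V \<and> V \<noteq> {} \<and> (\<forall>w\<in>V. \<exists>t\<in>W. F t = Some w)"
  by (simp add: quasi_open_def)

lemma partial_continuous_comp:
  fixes F :: "'b::topological_space \<rightharpoonup> 'c::topological_space"
    and G :: "'a::topological_space \<rightharpoonup> 'b"
  assumes "partial_continuous F" "partial_continuous G"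
  shows "partial_continuous (F \<circ>\<^sub>m G)"
  unfolding partial_continuous_def
proof (intro allI impI)
  fix V :: "'c set" assume "open V"
  then have "open {t. \<exists>w\<in>{s. \<exists>w\<in>V. F s = Some w}. G t = Some w}"
    using assms by (intro partial_continuousD)
  also have "{t. \<exists>w\<in>{s. \<exists>w\<in>V. F s = Some w}. G t = Some w}
      = {t. \<exists>w\<in>V. (F \<circ>\<^sub>m G) t = Some w}"
    by (auto simp: map_comp_Some_iff)
  finally show "open {t. \<exists>w\<in>V. (F \<circ>\<^sub>m G) t = Some w}" .
qed

lemma quasi_open_comp:
  fixes F :: "'b::topological_space \<rightharpoonup> 'c::topological_space"
    and G :: "'a::topological_space \<rightharpoonup> 'b"
  assumes F: "quasi_open F" and G: "quasi_open G"
  shows "quasi_open (F \<circ>\<^sub>m G)"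
  unfolding quasi_open_def
proof (intro allI impI)
  fix W :: "'a set" assume W: "open W" "W \<noteq> {}"
  obtain U where U: "open U" "U \<noteq> {}" "\<forall>s\<in>U. \<exists>t\<in>W. G t = Some s"
    using quasi_openD[OF G W] by blast
  obtain V where V: "open V" "V \<noteq> {}" "\<forall>w\<in>V. \<exists>s\<in>U. F s = Some w"
    using quasi_openD[OF F U(1,2)] by blast
  have "(\<forall>w\<in>V. \<exists>t\<in>W. (F \<circ>\<^sub>m G) t = Some w)"
  proof
    fix w assume "w \<in> V"
    then obtain s where s: "s \<in> U" "F s = Some w" using V(3) by blast
    then obtain t where "t \<in> W" "G t = Some s" using U(3) by blast
    with s(2) have "t \<in> W" "(F \<circ>\<^sub>m G) t = Some w" by (simp_all add: map_comp_Some_iff)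
    then show "\<exists>t\<in>W. (F \<circ>\<^sub>m G) t = Some w" ..
  qed
  with V show "\<exists>V. open V \<and> V \<noteq> {} \<and> (\<forall>w\<in>V. \<exists>t\<in>W. (F \<circ>\<^sub>m G) t = Some w)"
    by (intro exI[of _ V] conjI)
qed

lemma open_dom: "partial_continuous F \<Longrightarrow> open (dom F)"
  using partial_continuousD[of F UNIV] by (simp add: dom_def)

text \<open>
  A nonempty open set meets the open domain of the second map in a nonempty open set, which in turn
  meets the domain of the first.
\<close>

lemma dense_dom_Int:
  assumes F: "quasi_open F" and G: "quasi_open G" and "partial_continuous G"
  shows "closure (dom F \<inter> dom G) = UNIV"
proof -
  have "W \<inter> (dom F \<inter> dom G) \<noteq> {}" if W: "open W" "W \<noteq> {}" for W
  proof -
    obtain U where U: "U \<noteq> {}" "\<forall>w\<in>U. \<exists>t\<in>W. G t = Some w"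
      using quasi_openD[OF G W] by blast
    then have "W \<inter> dom G \<noteq> {}" by (auto simp: dom_def)
    moreover have "open (W \<inter> dom G)"
      using W(1) open_dom[OF assms(3)] by (rule open_Int)
    ultimately obtain V where "V \<noteq> {}" "\<forall>w\<in>V. \<exists>t\<in>W \<inter> dom G. F t = Some w"
      using quasi_openD[OF F, of "W \<inter> dom G"] by blast
    then obtain s where "s \<in> W \<inter> dom G" "s \<in> dom F" by blast
    then show ?thesis by blast
  qed
  then have "- closure (dom F \<inter> dom G) = {}"
    using closure_subset[of "dom F \<inter> dom G"] open_Compl[OF closed_closure, of "dom F \<inter> dom G"]
    by blast
  then show ?thesis by blast
qed

text \<open>
  The maps \<open>\<phi>\<close> and \<open>\<psi>\<close> are meant to be mutually inverse coordinate rearrangements that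
  expose the pair acted upon as the first factor; this treats the three actions on triples at once.
\<close>

definition on_factor :: "('c \<Rightarrow> 'a \<times> 's) \<Rightarrow> ('a \<times> 's \<Rightarrow> 'c) \<Rightarrow> ('a \<rightharpoonup> 'a) \<Rightarrow> 'c \<rightharpoonup> 'c" where
  "on_factor \<phi> \<psi> F = (\<lambda>t. map_option (\<lambda>p. \<psi> (p, snd (\<phi> t))) (F (fst (\<phi> t))))"

lemma partial_continuous_on_factor:
  fixes \<phi> :: "'c::topological_space \<Rightarrow> 'a::topological_space \<times> 's::topological_space"
  assumes F: "partial_continuous F"
    and \<phi>: "continuous_on UNIV \<phi>" and \<psi>: "continuous_on UNIV \<psi>"
  shows "partial_continuous (on_factor \<phi> \<psi> F)"
  unfolding partial_continuous_def
proof (intro allI impI)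
  fix V :: "'c set" assume V: "open V"
  define U where "U = {u. \<exists>p. F (fst u) = Some p \<and> \<psi> (p, snd u) \<in> V}"
  have "open U"
  proof (subst open_prod_def)
    show "\<forall>u\<in>U. \<exists>A B. open A \<and> open B \<and> u \<in> A \<times> B \<and> A \<times> B \<subseteq> U"
    proof
      fix u assume "u \<in> U"
      then obtain p where p: "F (fst u) = Some p" "(p, snd u) \<in> \<psi> -` V"
        by (auto simp: U_def)
      have "open (\<psi> -` V)" using V \<psi> by (rule open_vimage)
      then obtain A B where AB: "open A" "open B" "(p, snd u) \<in> A \<times> B" "A \<times> B \<subseteq> \<psi> -` V"
        using p(2) by (rule open_prod_elim)
      have "open {t. \<exists>w\<in>A. F t = Some w}" using F AB(1) by (rule partial_continuousD)
      moreover have "u \<in> {t. \<exists>w\<in>A. F t = Some w} \<times> B"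
        using p AB(3) by (cases u) auto
      moreover have "{t. \<exists>w\<in>A. F t = Some w} \<times> B \<subseteq> U"
        using AB(4) by (fastforce simp: U_def)
      ultimately show "\<exists>A B. open A \<and> open B \<and> u \<in> A \<times> B \<and> A \<times> B \<subseteq> U"
        using AB(2) by blast
    qed
  qed
  then have "open (\<phi> -` U)" using \<phi> by (rule open_vimage)
  also have "\<phi> -` U = {t. \<exists>w\<in>V. on_factor \<phi> \<psi> F t = Some w}"
    by (auto simp: U_def on_factor_def)
  finally show "open {t. \<exists>w\<in>V. on_factor \<phi> \<psi> F t = Some w}" .
qed

text \<open>
  It suffices to look at a box \<open>A \<times> B\<close>: its image under \<open>F \<times> id\<close> contains
  \<open>V \<times> B\<close> for an open \<open>V\<close> covered by \<open>F\<close> on \<open>A\<close>.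
\<close>

lemma quasi_open_on_factor:
  fixes \<phi> :: "'c::topological_space \<Rightarrow> 'a::topological_space \<times> 's::topological_space"
  assumes F: "quasi_open F"
    and \<phi>: "continuous_on UNIV \<phi>" and \<psi>: "continuous_on UNIV \<psi>"
    and inv: "\<And>t. \<psi> (\<phi> t) = t" "\<And>s. \<phi> (\<psi> s) = s"
  shows "quasi_open (on_factor \<phi> \<psi> F)"
  unfolding quasi_open_def
proof (intro allI impI)
  fix W :: "'c set" assume W: "open W" "W \<noteq> {}"
  then obtain t0 where "t0 \<in> W" by blast
  then have "\<phi> t0 \<in> \<psi> -` W" by (simp add: inv)
  moreover have "open (\<psi> -` W)" using W(1) \<psi> by (rule open_vimage)
  ultimately obtain A B where AB: "open A" "open B" "\<phi> t0 \<in> A \<times> B" "A \<times> B \<subseteq> \<psi> -` W"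
    using open_prod_elim[of "\<psi> -` W" "\<phi> t0"] by blast
  then have "A \<noteq> {}" by auto
  then obtain V where V: "open V" "V \<noteq> {}" "\<forall>w\<in>V. \<exists>t\<in>A. F t = Some w"
    using quasi_openD[OF F AB(1)] by blast
  have "open (\<phi> -` (V \<times> B))" using open_Times[OF V(1) AB(2)] \<phi> by (rule open_vimage)
  moreover obtain v where "v \<in> V" using V(2) by blast
  then have "\<psi> (v, snd (\<phi> t0)) \<in> \<phi> -` (V \<times> B)" using AB(3) by (auto simp: inv mem_Times_iff)
  moreover have "\<forall>w\<in>\<phi> -` (V \<times> B). \<exists>t\<in>W. on_factor \<phi> \<psi> F t = Some w"
  proof
    fix w assume w: "w \<in> \<phi> -` (V \<times> B)"
    then obtain s where s: "s \<in> A" "F s = Some (fst (\<phi> w))"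
      using V(3) by (metis mem_Times_iff vimage_eq)
    have "\<psi> (s, snd (\<phi> w)) \<in> W" using AB(4) s w by (auto simp: mem_Times_iff)
    moreover have "on_factor \<phi> \<psi> F (\<psi> (s, snd (\<phi> w))) = Some w"
      by (simp add: on_factor_def inv s)
    ultimately show "\<exists>t\<in>W. on_factor \<phi> \<psi> F t = Some w" ..
  qed
  ultimately show "\<exists>V. open V \<and> V \<noteq> {} \<and> (\<forall>w\<in>V. \<exists>t\<in>W. on_factor \<phi> \<psi> F t = Some w)"
    by (intro exI[of _ "\<phi> -` (V \<times> B)"] conjI) auto
qed

lemma act12_on_factor:
  "act12 F = on_factor (\<lambda>(x, y, z). ((x, y), z)) (\<lambda>((x, y), z). (x, y, z)) F"
  by (auto simp: act12_def on_factor_def fun_eq_iff intro!: option.map_cong)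

lemma act13_on_factor:
  "act13 F = on_factor (\<lambda>(x, y, z). ((x, z), y)) (\<lambda>((x, z), y). (x, y, z)) F"
  by (auto simp: act13_def on_factor_def fun_eq_iff intro!: option.map_cong)

lemma act23_on_factor:
  "act23 F = on_factor (\<lambda>(x, y, z). ((y, z), x)) (\<lambda>((y, z), x). (x, y, z)) F"
  by (auto simp: act23_def on_factor_def fun_eq_iff intro!: option.map_cong)

lemma partial_continuous_act:
  assumes "partial_continuous F"
  shows "partial_continuous (act12 F)" "partial_continuous (act13 F)" "partial_continuous (act23 F)"
  unfolding act12_on_factor act13_on_factor act23_on_factor
  by (intro partial_continuous_on_factor assms; simp add: split_beta; intro continuous_intros)+

lemma quasi_open_act:
  assumes "quasi_open F"
  shows "quasi_open (act12 F)" "quasi_open (act13 F)" "quasi_open (act23 F)"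
  unfolding act12_on_factor act13_on_factor act23_on_factor
  by (rule quasi_open_on_factor; (simp add: split_beta assms)?; intro continuous_intros)+

section \<open>The map R in coordinates\<close>

text \<open>
  After clearing denominators, the numerator of \<open>P\<close> becomes \<open>k * a + y + l - k\<close>, so that
  definedness is the nonvanishing of four polynomials.
\<close>

lemma R_map_eq_Some_iff:
  "R_map k l ((a, x), (b, y)) = Some ((p1, p2), (q1, q2)) \<longleftrightarrow>
     l * a + y \<noteq> 0 \<and> k * a + y \<noteq> 0 \<and> x \<noteq> 0 \<and> k * a + y + l - k \<noteq> 0 \<and>
     p1 = b * (l * a + y) / (k * a + y + l - k) \<and>
     p2 = y * (k * a + y + l - k) / (l * a + y) \<and>
     q1 = a * (k * a + y + l - k) / (l * a + y) \<and>
     q2 = (x * (l * a + y) + (k - l) * y) / (k * a + y)"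
proof (cases "l * a + y \<noteq> 0 \<and> k * a + y \<noteq> 0 \<and> x \<noteq> 0")
  case True
  have P: "P_factor k l (a, x) (b, y) = (k * a + y + l - k) / (l * a + y)"
    using True by (simp add: P_factor_def divide_simps) (simp add: algebra_simps)
  have Q: "x * Q_factor k l (a, x) (b, y) = (x * (l * a + y) + (k - l) * y) / (k * a + y)"
    using True by (simp add: Q_factor_def divide_simps) (simp add: algebra_simps)
  show ?thesis using True by (auto simp: R_map_def P Q divide_simps)
qed (auto simp: R_map_def)

text \<open>
  The quantity \<open>P\<close> can be recovered from the image: in the new coordinates
  \<open>l * q1 + p2\<close> equals the old numerator of \<open>P\<close>, and \<open>(l * q1 + p2 + k - l) / (k * q1 + p2)\<close>
  is \<open>1 / P\<close>, which is the factor of the map with interchanged parameters at \<open>(q, p)\<close>.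
  The hypothesis on \<open>q\<close> is the one definedness condition of that map that is not inherited.
\<close>

lemma R_map_reversible:
  assumes "R_map k l (s, t) = Some (p, q)" "snd q \<noteq> 0"
  shows "R_map l k (q, p) = Some (t, s)"
proof -
  obtain a x b y p1 p2 q1 q2 where [simp]: "s = (a, x)" "t = (b, y)" "p = (p1, p2)" "q = (q1, q2)"
    by (metis surj_pair)
  define N where "N = k * a + y + l - k"
  define D1 where "D1 = k * a + y"
  define D2 where "D2 = l * a + y"
  have nz: "D2 \<noteq> 0" "D1 \<noteq> 0" "x \<noteq> 0" "N \<noteq> 0" "q2 \<noteq> 0"
    and eqs: "p1 = b * D2 / N" "p2 = y * N / D2" "q1 = a * N / D2" "q2 = (x * D2 + (k - l) * y) / D1"
    using assms by (auto simp: R_map_eq_Some_iff N_def D1_def D2_def)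
  have k: "k * q1 + p2 = N * D1 / D2"
    using nz by (simp add: eqs D1_def field_simps)
  have l: "l * q1 + p2 = N"
    using nz by (simp add: eqs field_simps) (simp add: D2_def algebra_simps)
  have lk: "l * q1 + p2 + k - l = D1"
    unfolding l by (simp add: N_def D1_def)
  show ?thesis
    unfolding \<open>s = _\<close> \<open>t = _\<close> \<open>p = _\<close> \<open>q = _\<close> R_map_eq_Some_iff k l lk
    using nz by (simp add: eqs divide_simps) (simp add: D1_def D2_def N_def algebra_simps)
qed

lemma partial_continuous_R_map: "partial_continuous (R_map k l)"
proof -
  define D :: "(C2 \<times> C2) set" where "D = {((a, x), (b, y)). l * a + y \<noteq> 0 \<and> k * a + y \<noteq> 0 \<and> x \<noteq> 0 \<and> k * a + y + l - k \<noteq> 0}"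
  define f :: "C2 \<times> C2 \<Rightarrow> C2 \<times> C2" where "f = (\<lambda>((a, x), (b, y)).
     ((b * (l * a + y) / (k * a + y + l - k), y * (k * a + y + l - k) / (l * a + y)),
      (a * (k * a + y + l - k) / (l * a + y), (x * (l * a + y) + (k - l) * y) / (k * a + y))))"
  have R: "R_map k l t = Some w \<longleftrightarrow> t \<in> D \<and> w = f t" for t w
  proof -
    obtain a x b y p1 p2 q1 q2 where "t = ((a, x), (b, y))" "w = ((p1, p2), (q1, q2))"
      by (metis surj_pair)
    then show ?thesis by (simp add: D_def f_def R_map_eq_Some_iff)
  qed
  have D: "open D"
    unfolding D_def split_beta
    by (intro open_Collect_conj open_Collect_neq continuous_intros)
  have f: "continuous_on D f"
    unfolding f_def split_beta D_def
    by (intro continuous_intros) auto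
  show ?thesis
    unfolding partial_continuous_def
  proof (intro allI impI)
    fix V :: "(C2 \<times> C2) set" assume "open V"
    then have "open (D \<inter> f -` V)" by (rule continuous_open_preimage[OF f D])
    also have "D \<inter> f -` V = {t. \<exists>w\<in>V. R_map k l t = Some w}" by (auto simp: R)
    finally show "open {t. \<exists>w\<in>V. R_map k l t = Some w}" .
  qed
qed

lemma open_avoids_finite:
  fixes U :: "complex set"
  assumes "open U" "z \<in> U" "finite A"
  obtains w where "w \<in> U" "w \<notin> A"
proof -
  have "infinite U" using assms(1,2) by (metis finite_imp_not_open ex_in_conv)
  then show ?thesis using assms(3) that by (metis finite_subset subsetI)
qed

text \<open>
  By reversibility the image of an open set contains its preimage under the reversed map, which is
  open. Only its nonemptiness needs an argument: a given point is moved to one where both the map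
  and its reversal are defined. Every condition is affine and nonconstant in \<open>y\<close>, the second
  coordinate of the second argument, or, once \<open>y\<close> is chosen, in \<open>x\<close>, the second coordinate
  of the first argument, so each step excludes finitely many values.
\<close>

lemma quasi_open_R_map: "quasi_open (R_map k l)"
  unfolding quasi_open_def
proof (intro allI impI)
  fix W :: "(C2 \<times> C2) set" assume W: "open W" "W \<noteq> {}"
  \<comment> \<open>Reversing the reversal requires a nonzero second coordinate of the first argument.\<close>
  define W' where "W' = W \<inter> {w. snd (fst w) \<noteq> 0}"
  have W': "open W'" unfolding W'_def
    by (intro open_Int W(1) open_Collect_neq continuous_intros)
  define V where "V = {w. \<exists>t\<in>prod.swap -` W'. R_map l k (prod.swap w) = Some t}"
  have "open (prod.swap -` W')"
    using W' by (rule open_vimage) (simp add: prod.swap_def, intro continuous_intros)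
  then have "open {w. \<exists>t\<in>prod.swap -` W'. R_map l k w = Some t}"
    by (rule partial_continuousD[OF partial_continuous_R_map])
  then have "open (prod.swap -` {w. \<exists>t\<in>prod.swap -` W'. R_map l k w = Some t})"
    by (rule open_vimage) (simp add: prod.swap_def, intro continuous_intros)
  then have "open V" by (simp add: V_def vimage_def)
  moreover have "V \<noteq> {}"
  proof -
    obtain a x0 b y0 where t0: "((a, x0), (b, y0)) \<in> W" using W(2) by (metis ex_in_conv surj_pair)
    have "open ((\<lambda>y. ((a, x0), (b, y))) -` W)"
      using W(1) by (rule open_vimage) (intro continuous_intros)
    then obtain y where y: "((a, x0), (b, y)) \<in> W" "y \<notin> {- l * a, - k * a, k - l - k * a}"
      using t0 by (elim open_avoids_finite[where A = "{- l * a, - k * a, k - l - k * a}"]) auto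
    have "open ((\<lambda>x. ((a, x), (b, y))) -` W)"
      using W(1) by (rule open_vimage) (intro continuous_intros)
    then obtain x where x: "((a, x), (b, y)) \<in> W" "x \<notin> {0, - ((k - l) * y) / (l * a + y)}"
      using y(1) by (elim open_avoids_finite[where A = "{0, - ((k - l) * y) / (l * a + y)}"]) auto
    have nz: "l * a + y \<noteq> 0" "k * a + y \<noteq> 0" "x \<noteq> 0" "k * a + y + l - k \<noteq> 0"
      using y(2) x(2) by (auto simp: algebra_simps add_eq_0_iff)
    have "x * (l * a + y) + (k - l) * y \<noteq> 0"
    proof
      assume "x * (l * a + y) + (k - l) * y = 0"
      then have "x = - ((k - l) * y) / (l * a + y)"
        unfolding eq_neg_iff_add_eq_0[symmetric] using nz(1) by (simp add: field_simps)
      then show False using x(2) by simp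
    qed
    with nz obtain p q where "R_map k l ((a, x), (b, y)) = Some (p, q)" "snd q \<noteq> 0"
      using R_map_eq_Some_iff[of k l a x b y] by fastforce
    then have "R_map l k (q, p) = Some ((b, y), (a, x))" by (rule R_map_reversible)
    then have "(p, q) \<in> V" using x(1) nz by (auto simp: V_def W'_def)
    then show ?thesis by blast
  qed
  moreover have "\<forall>w\<in>V. \<exists>t\<in>W. R_map k l t = Some w"
  proof
    fix w assume "w \<in> V"
    then obtain t where t: "prod.swap t \<in> W'" "R_map l k (prod.swap w) = Some t"
      by (auto simp: V_def)
    have "R_map k l (prod.swap t) = Some w"
      using R_map_reversible[of l k "snd w" "fst w" "fst t" "snd t"] t
      by (simp add: W'_def prod.swap_def)
    then show "\<exists>t\<in>W. R_map k l t = Some w" using t(1) by (auto simp: W'_def)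
  qed
  ultimately show "\<exists>V. open V \<and> V \<noteq> {} \<and> (\<forall>w\<in>V. \<exists>t\<in>W. R_map k l t = Some w)"
    by (intro exI[of _ V] conjI)
qed

section \<open>The map on solutions of the lattice equations\<close>

text \<open>
  In the field variables the denominators of \<open>R\<close> are \<open>u / u1\<close> times those of the lattice
  equations, and the numerator of \<open>P\<close> is \<open>u12 / u1\<close> times the denominator of the first one.
\<close>

lemma R_map_of_quad_equations:
  fixes k l u v u1 u2 v2 u12 v12 :: complex
  assumes nz: "u \<noteq> 0" "v \<noteq> 0" "u1 \<noteq> 0" "u12 \<noteq> 0" "l + u1 * v2 \<noteq> 0" "k + u1 * v2 \<noteq> 0"
    and u12: "u12 = u + (l - k) * ((u1 - u) / (l + u1 * v2))"
    and v12: "v12 = v + (k - l) * ((v2 - v) / (k + u1 * v2))"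
  shows "R_map k l ((u / u1, v * u1), (u2 / u, u * v2))
           = Some ((u2 / u12, v2 * u12), (u12 / u1, u1 * v12))"
proof -
  define A where "A = l + u1 * v2"
  define B where "B = k + u1 * v2"
  have "A \<noteq> 0" "B \<noteq> 0" using nz by (simp_all add: A_def B_def)
  note nz = nz(1-4) this
  have u: "u12 * A = u * A + (l - k) * (u1 - u)"
    unfolding u12 A_def[symmetric] using nz by (simp add: field_simps)
  have v: "v12 * B = v * B + (k - l) * (v2 - v)"
    unfolding v12 B_def[symmetric] using nz by (simp add: field_simps)
  have D2: "l * (u / u1) + u * v2 = u * A / u1" and D1: "k * (u / u1) + u * v2 = u * B / u1"
    using nz by (simp_all add: A_def B_def field_simps)
  have N: "u * B / u1 + l - k = u12 * A / u1"
    unfolding u using nz by (simp add: divide_simps) (simp add: A_def B_def algebra_simps)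
  have "u1 * v12 = (v * u1 * (u * A / u1) + (k - l) * (u * v2)) / (u * B / u1)"
    using nz v by (simp add: divide_simps) (simp add: A_def B_def, algebra)
  then show ?thesis
    unfolding R_map_eq_Some_iff D1 D2 N using nz by (simp add: divide_simps)
qed

section \<open>Closed form of the triple compositions\<close>

text \<open>
  The compositions are evaluated at the triple with entries \<open>(a, x)\<close>, \<open>(b, y)\<close>,
  \<open>(c, z)\<close> and parameters \<open>k\<close>, \<open>l\<close>, \<open>m\<close>. No factor \<open>P\<close> involves \<open>x\<close> or
  \<open>c\<close>, which enter only the result, affinely; the remaining data are fixed below.

  The polynomials \<open>yb_D1\<close>, \<open>yb_D2\<close>, \<open>yb_N\<close> and then \<open>yb_K\<close>, \<open>yb_M\<close>, \<open>yb_L\<close> come from the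
  composition that begins with the pair (1,2); \<open>yb_E2\<close>, \<open>yb_E3\<close>, \<open>yb_S\<close>, \<open>yb_T\<close>
  and then \<open>yb_Z\<close>, \<open>yb_W\<close>, \<open>yb_V\<close> come from the one that begins with the pair (2,3).
  In each group the former are the data of the first step and the latter the denominators
  and the numerator of \<open>P\<close> in the second step;
  \<open>yb_Y\<close> arises from the factor \<open>Q\<close> in the second step of the first group. The third step of either composition leads to the
  polynomials of the other.
\<close>

context
  fixes k l m a b y z :: complex
begin

definition "yb_D1 = k * a + y"
definition "yb_D2 = l * a + y"
definition "yb_N = k * a + y + l - k"
definition "yb_E2 = l * b + z"
definition "yb_E3 = m * b + z"
definition "yb_S = l * b + z + m - l"
definition "yb_K = k * b * yb_D2 + z * yb_N"
definition "yb_M = m * b * yb_D2 + z * yb_N"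
definition "yb_L = k * b * yb_D2 + (z + m - k) * yb_N"
definition "yb_T = y * yb_E3 + (l - m) * z"
definition "yb_Y = y * yb_M + (k - m) * z * yb_D2"
definition "yb_Z = m * a * yb_E2 + yb_T"
definition "yb_W = k * a * yb_E2 + yb_T"
definition "yb_V = k * a * yb_E2 + yb_T + (m - k) * yb_E2"

definition yb_image :: "complex \<Rightarrow> complex \<Rightarrow> C2 \<times> C2 \<times> C2" where
  "yb_image x c =
     ((c * yb_M / yb_L, z * yb_L / yb_M),
      (b * yb_L * yb_Z / (yb_M * yb_V), yb_Y * yb_V / (yb_K * yb_Z)),
      (a * yb_V / yb_Z, (x * yb_Z + (k - m) * yb_T) / yb_W))"

lemmas yb_defs = yb_D1_def yb_D2_def yb_N_def yb_E2_def yb_E3_def yb_S_def yb_K_def yb_M_def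
  yb_L_def yb_T_def yb_Y_def yb_Z_def yb_W_def yb_V_def

text \<open>
  The left-hand sides are the denominators and numerators, over a common denominator, that occur in
  the third steps. The first three and the last belong to the composition beginning with (1,2), the
  other four to the one beginning with (2,3). The extra factor on the right (\<open>yb_D1\<close>,
  \<open>yb_D2\<close>, \<open>yb_E2\<close> or \<open>yb_E3\<close>) cancels in the composition and leaves
  polynomials that both sides share.
\<close>

lemma yb_factorisations:
  "m * a * yb_K + yb_Y = yb_D1 * yb_Z"
  "l * a * yb_K + yb_Y = yb_D2 * yb_W"
  "yb_N * yb_W + (m - l) * yb_K = yb_D1 * yb_V"
  "l * b * yb_Z + z * yb_V = yb_E2 * yb_M"
  "k * b * yb_Z + z * yb_V = yb_E3 * yb_K"
  "yb_S * yb_K + (l - k) * yb_V = yb_E2 * yb_L"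
  "yb_T * yb_M + (k - l) * z * yb_Z = yb_E3 * yb_Y"
  "(k - l) * y * yb_Z + (l - m) * yb_Y = (k - m) * yb_D2 * yb_T"
  unfolding yb_defs by algebra+

text \<open>
  Definedness of the successive steps yields, one group at a time, that the polynomials
  in the denominators do not vanish; this is what permits the cancellations.
\<close>

lemma yb_left:
  assumes 1: "R_map k l ((a, x), (b, y)) = Some (p, q)"
    and 2: "R_map k m (p, (c, z)) = Some (p', r)"
    and 3: "R_map l m (q, r) = Some (q', r')"
  shows "(p', q', r') = yb_image x c"
proof -
  obtain p1 p2 q1 q2 r1 r2 where pqr: "p = (p1, p2)" "q = (q1, q2)" "r = (r1, r2)"
    by (metis surj_pair)
  have nz1: "yb_D2 \<noteq> 0" "yb_D1 \<noteq> 0" "yb_N \<noteq> 0"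
    and pq: "p1 = b * yb_D2 / yb_N" "p2 = y * yb_N / yb_D2" "q1 = a * yb_N / yb_D2"
      "q2 = (x * yb_D2 + (k - l) * y) / yb_D1"
    using 1 by (simp_all add: pqr R_map_eq_Some_iff yb_D1_def yb_D2_def yb_N_def)
  have d2: "m * p1 + z = yb_M / yb_N" "k * p1 + z = yb_K / yb_N" "yb_K / yb_N + m - k = yb_L / yb_N"
    using nz1 by (simp_all add: pq yb_M_def yb_K_def yb_L_def field_simps)
  have nz2: "yb_M \<noteq> 0" "yb_K \<noteq> 0" "yb_L \<noteq> 0"
    and p': "p' = (c * yb_M / yb_L, z * yb_L / yb_M)"
    and r1: "r1 = p1 * yb_L / yb_M"
    and r2': "r2 = (p2 * (yb_M / yb_N) + (k - m) * z) / (yb_K / yb_N)"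
    using 2 nz1 by (cases p'; auto simp: pqr R_map_eq_Some_iff d2)+
  have r2: "r2 = yb_N * yb_Y / (yb_D2 * yb_K)"
    unfolding r2' using nz1 nz2 by (simp add: pq divide_simps) (simp add: yb_Y_def algebra_simps)
  have "m * q1 + r2 = yb_N * (m * a * yb_K + yb_Y) / (yb_D2 * yb_K)"
    "l * q1 + r2 = yb_N * (l * a * yb_K + yb_Y) / (yb_D2 * yb_K)"
    using nz1 nz2 by (simp_all add: pq r2 field_simps)
  then have d3: "m * q1 + r2 = yb_N * yb_D1 * yb_Z / (yb_D2 * yb_K)" "l * q1 + r2 = yb_N * yb_W / yb_K"
    using nz1 nz2 by (simp_all add: yb_factorisations)
  have "yb_N * yb_W / yb_K + m - l = (yb_N * yb_W + (m - l) * yb_K) / yb_K"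
    using nz2 by (simp add: field_simps)
  then have d3': "yb_N * yb_W / yb_K + m - l = yb_D1 * yb_V / yb_K"
    by (simp add: yb_factorisations)
  have nz3: "yb_Z \<noteq> 0" "yb_W \<noteq> 0" "yb_V \<noteq> 0"
    and q': "q' = (r1 * (yb_N * yb_D1 * yb_Z / (yb_D2 * yb_K)) / (yb_D1 * yb_V / yb_K),
                   r2 * (yb_D1 * yb_V / yb_K) / (yb_N * yb_D1 * yb_Z / (yb_D2 * yb_K)))"
    and r': "r' = (q1 * (yb_D1 * yb_V / yb_K) / (yb_N * yb_D1 * yb_Z / (yb_D2 * yb_K)),
                   (q2 * (yb_N * yb_D1 * yb_Z / (yb_D2 * yb_K)) + (l - m) * r2) / (yb_N * yb_W / yb_K))"
    using 3 nz1 nz2 by (cases q'; cases r'; auto simp: pqr R_map_eq_Some_iff d3 d3')+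
  note nz = nz1 nz2 nz3
  have "q' = (b * yb_L * yb_Z / (yb_M * yb_V), yb_Y * yb_V / (yb_K * yb_Z))"
    using nz by (simp add: q' r1 r2 pq field_simps)
  moreover have "fst r' = a * yb_V / yb_Z"
    using nz by (simp add: r' pq field_simps)
  moreover have "snd r' = (x * yb_Z + (k - m) * yb_T) / yb_W"
  proof -
    have "snd r' = (x * yb_D2 * yb_Z + ((k - l) * y * yb_Z + (l - m) * yb_Y)) / (yb_D2 * yb_W)"
      using nz by (simp add: r' r2 pq divide_simps) (simp add: algebra_simps)
    also have "\<dots> = (x * yb_Z + (k - m) * yb_T) / yb_W"
      unfolding yb_factorisations using nz by (simp add: divide_simps) (simp add: algebra_simps)
    finally show ?thesis .
  qed
  ultimately show ?thesis by (simp add: yb_image_def p' prod_eq_iff)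
qed

lemma yb_right:
  assumes 1: "R_map l m ((b, y), (c, z)) = Some (p, q)"
    and 2: "R_map k m ((a, x), q) = Some (r, s)"
    and 3: "R_map k l (r, p) = Some (p', q')"
  shows "(p', q', s) = yb_image x c"
proof -
  obtain p1 p2 q1 q2 r1 r2 where pqr: "p = (p1, p2)" "q = (q1, q2)" "r = (r1, r2)"
    by (metis surj_pair)
  have nz1: "yb_E2 \<noteq> 0" "yb_E3 \<noteq> 0" "yb_S \<noteq> 0"
    and pq: "p1 = c * yb_E3 / yb_S" "p2 = z * yb_S / yb_E3" "q1 = b * yb_S / yb_E3"
      "q2 = yb_T / yb_E2"
    using 1 by (simp_all add: pqr R_map_eq_Some_iff yb_E2_def yb_E3_def yb_S_def yb_T_def)
  have d2: "m * a + q2 = yb_Z / yb_E2" "k * a + q2 = yb_W / yb_E2"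
    "yb_W / yb_E2 + m - k = yb_V / yb_E2"
    using nz1 by (simp_all add: pq yb_Z_def yb_W_def yb_V_def add_divide_distrib diff_divide_distrib)
  have nz2: "yb_Z \<noteq> 0" "yb_W \<noteq> 0" "yb_V \<noteq> 0"
    and r': "r1 = q1 * (yb_Z / yb_E2) / (yb_V / yb_E2)" "r2 = q2 * (yb_V / yb_E2) / (yb_Z / yb_E2)"
    and s': "s = (a * (yb_V / yb_E2) / (yb_Z / yb_E2),
                  (x * (yb_Z / yb_E2) + (k - m) * q2) / (yb_W / yb_E2))"
    using 2 nz1 by (cases s; auto simp: pqr R_map_eq_Some_iff d2)+
  have r: "r1 = b * yb_S * yb_Z / (yb_E3 * yb_V)" "r2 = yb_T * yb_V / (yb_E2 * yb_Z)"
    using nz1 nz2 by (simp_all add: r' pq)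
  have s: "s = (a * yb_V / yb_Z, (x * yb_Z + (k - m) * yb_T) / yb_W)"
    using nz1 nz2 by (simp add: s' pq divide_simps)
  have "l * r1 + p2 = yb_S * (l * b * yb_Z + z * yb_V) / (yb_E3 * yb_V)"
    "k * r1 + p2 = yb_S * (k * b * yb_Z + z * yb_V) / (yb_E3 * yb_V)"
    using nz1 nz2 by (simp_all add: pq r field_simps)
  then have d3: "l * r1 + p2 = yb_S * yb_E2 * yb_M / (yb_E3 * yb_V)" "k * r1 + p2 = yb_S * yb_K / yb_V"
    using nz1 nz2 by (simp_all add: yb_factorisations)
  have "yb_S * yb_K / yb_V + l - k = (yb_S * yb_K + (l - k) * yb_V) / yb_V"
    using nz2 by (simp add: field_simps)
  then have d3': "yb_S * yb_K / yb_V + l - k = yb_E2 * yb_L / yb_V"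
    by (simp add: yb_factorisations)
  have nz3: "yb_M \<noteq> 0" "yb_K \<noteq> 0" "yb_L \<noteq> 0"
    and p': "p' = (p1 * (yb_S * yb_E2 * yb_M / (yb_E3 * yb_V)) / (yb_E2 * yb_L / yb_V),
                   p2 * (yb_E2 * yb_L / yb_V) / (yb_S * yb_E2 * yb_M / (yb_E3 * yb_V)))"
    and q': "q' = (r1 * (yb_E2 * yb_L / yb_V) / (yb_S * yb_E2 * yb_M / (yb_E3 * yb_V)),
                   (r2 * (yb_S * yb_E2 * yb_M / (yb_E3 * yb_V)) + (k - l) * p2) / (yb_S * yb_K / yb_V))"
    using 3 nz1 nz2 by (cases p'; cases q'; auto simp: pqr R_map_eq_Some_iff d3 d3')+
  note nz = nz1 nz2 nz3
  have "p' = (c * yb_M / yb_L, z * yb_L / yb_M)"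
    using nz by (simp add: p' pq field_simps)
  moreover have "fst q' = b * yb_L * yb_Z / (yb_M * yb_V)"
    using nz by (simp add: q' r pq field_simps)
  moreover have "snd q' = yb_Y * yb_V / (yb_K * yb_Z)"
  proof -
    have "snd q' = (yb_T * yb_M + (k - l) * z * yb_Z) * yb_V / (yb_E3 * yb_K * yb_Z)"
      using nz by (simp add: q' r pq divide_simps) (simp add: algebra_simps)
    also have "\<dots> = yb_Y * yb_V / (yb_K * yb_Z)"
      unfolding yb_factorisations using nz by simp
    finally show ?thesis .
  qed
  ultimately show ?thesis by (simp add: yb_image_def s prod_eq_iff)
qed

end

theorem mainTheorem5:
  shows
    "(\<forall>(\<beta>1::complex) \<beta>2 u v u1 u2 v2 u12 v12.
        u \<noteq> 0 \<and> v \<noteq> 0 \<and> u1 \<noteq> 0 \<and> u12 \<noteq> 0 \<and> \<beta>2 + u1 * v2 \<noteq> 0 \<and> \<beta>1 + u1 * v2 \<noteq> 0 \<and>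
        u12 = u + (\<beta>2 - \<beta>1) * ((u1 - u) / (\<beta>2 + u1 * v2)) \<and>
        v12 = v + (\<beta>1 - \<beta>2) * ((v2 - v) / (\<beta>1 + u1 * v2))
        \<longrightarrow> R_map \<beta>1 \<beta>2 ((u / u1, v * u1), (u2 / u, u * v2))
            = Some ((u2 / u12, v2 * u12), (u12 / u1, u1 * v12)))
     \<and>
     (\<forall>(\<beta>1::complex) \<beta>2 \<beta>3.
        rational_map_eq
          (act23 (R_map \<beta>2 \<beta>3) \<circ>\<^sub>m act13 (R_map \<beta>1 \<beta>3) \<circ>\<^sub>m act12 (R_map \<beta>1 \<beta>2))
          (act12 (R_map \<beta>1 \<beta>2) \<circ>\<^sub>m act13 (R_map \<beta>1 \<beta>3) \<circ>\<^sub>m act23 (R_map \<beta>2 \<beta>3)))"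
    (is "?quad \<and> (\<forall>\<beta>1 \<beta>2 \<beta>3. rational_map_eq (?F \<beta>1 \<beta>2 \<beta>3) (?G \<beta>1 \<beta>2 \<beta>3))")
proof (intro conjI)
  show ?quad by (intro allI impI) (elim conjE, rule R_map_of_quad_equations)
  show "\<forall>\<beta>1 \<beta>2 \<beta>3. rational_map_eq (?F \<beta>1 \<beta>2 \<beta>3) (?G \<beta>1 \<beta>2 \<beta>3)"
  proof (intro allI)
    fix k l m :: complex
    have F: "partial_continuous (?F k l m)" "quasi_open (?F k l m)"
      by (intro partial_continuous_comp partial_continuous_act partial_continuous_R_map
            quasi_open_comp quasi_open_act quasi_open_R_map)+
    have G: "partial_continuous (?G k l m)" "quasi_open (?G k l m)"
      by (intro partial_continuous_comp partial_continuous_act partial_continuous_R_map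
            quasi_open_comp quasi_open_act quasi_open_R_map)+
    have "?F k l m t = ?G k l m t" if t: "t \<in> dom (?F k l m) \<inter> dom (?G k l m)" for t
    proof -
      obtain a x b y c z where [simp]: "t = ((a, x), (b, y), (c, z))" by (metis surj_pair)
      have "?F k l m t = Some (yb_image k l m a b y z x c)"
        using t by (auto simp: dom_def map_comp_Some_iff act12_def act13_def act23_def dest: yb_left)
      moreover have "?G k l m t = Some (yb_image k l m a b y z x c)"
        using t by (auto simp: dom_def map_comp_Some_iff act12_def act13_def act23_def dest: yb_right)
      ultimately show ?thesis by simp
    qed
    then show "rational_map_eq (?F k l m) (?G k l m)"
      unfolding rational_map_eq_def
      using open_Int[OF F(1)[THEN open_dom] G(1)[THEN open_dom]] dense_dom_Int[OF F(2) G(2,1)]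
      by blast
  qed
qed

end
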